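(* Let $q,a,b\in\mathbb C$ be nonzero with $q^m\neq 1$ for all $m=1,2,\dots$. Let $\mathcal A=\mathbb C[z,z^{-1}]$ be the space of Laurent polynomials $f[z]$. Then the following formulas define a faithful representation of the algebra $\mathcal H_{\rm III}$ on $\mathcal A$: $$(T_0 f)[z]:=-\frac{z}{q-z^2}\left(f[z]-f[q z^{-1}]\right),$$ $$(T_1 f)[z]:=\frac{(a+b)z-(1+ab)}{1-z^2}f[z]+\frac{(1-az)(1-bz)}{1-z^2}f[z^{-1}],$$ $$(Xf)[z]:=z f[z].$$ That is, these operators map $\mathcal A$ to itself, they extend to an algebra homomorphism $\mathcal H_{\rm III}\to \mathrm{End}_{\mathbb C}(\mathcal A)$ (with $X^{-1}$ acting as multiplication by $z^{-1}$), and this homomorphism is injective.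
   Context: $\mathcal H_{\rm III}$ is the unital associative $\mathbb C$-algebra (depending on parameters $q,a,b$) generated by $T_0,T_1,X^{\pm1}$ (with $XX^{-1}=X^{-1}X=1$) with defining relations $$(T_1+ab)(T_1+1)=0,\qquad T_0^2=0,\qquad (T_1X+a)(T_1X+b)=0,\qquad qT_0X^{-1}+1=XT_0.$$ *)

theory Defs
  imports
    "HOL-Library.Poly_Mapping"
    "HOL-Computational_Algebra.Polynomial_Factorial"
    "HOL-Algebra.QuotRing"
begin

section \<open>The free unital associative algebra\<close>

text \<open>
  The free monoid is written additively, because the convolution product of \<^typ>\<open>'m \<Rightarrow>\<^sub>0 'c\<close>
  is indexed by an additive monoid. The monoid is not commutative.
\<close>

datatype 'g free_monoid = Word (letters: "'g list")

instantiation free_monoid :: (type) monoid_add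
begin

definition zero_free_monoid :: "'g free_monoid" where
  "zero_free_monoid = Word []"

definition plus_free_monoid :: "'g free_monoid \<Rightarrow> 'g free_monoid \<Rightarrow> 'g free_monoid" where
  "plus_free_monoid u v = Word (letters u @ letters v)"

instance
  by standard (simp_all add: zero_free_monoid_def plus_free_monoid_def)

end

type_synonym 'g free_alg = "'g free_monoid \<Rightarrow>\<^sub>0 complex"

definition gen :: "'g \<Rightarrow> 'g free_alg" where
  "gen g = Poly_Mapping.single (Word [g]) 1"

text \<open>The scalar \<open>c\<close>, viewed as the constant \<open>c \<cdot> 1\<close>, in any monoid algebra over the complex numbers.\<close>

definition const :: "complex \<Rightarrow> ('m::monoid_add \<Rightarrow>\<^sub>0 complex)" where
  "const c = Poly_Mapping.single 0 c"

definition free_alg_ring :: "'g free_alg ring" where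
  "free_alg_ring = \<lparr>carrier = UNIV, mult = (*), one = 1, zero = 0, add = (+)\<rparr>"

lemma ring_free_alg_ring: "ring free_alg_ring"
  by (intro ringI abelian_groupI monoidI)
    (auto simp: free_alg_ring_def algebra_simps intro: exI[of _ "- x" for x])


section \<open>The algebra \<open>\<H>\<^bsub>III\<^esub>\<close>\<close>

text \<open>\<open>GXi\<close> is the generator standing for the inverse of \<open>X\<close>.\<close>

datatype hgen = GT0 | GT1 | GX | GXi

text \<open>A relation \<open>l = r\<close> is encoded by the element \<open>l - r\<close>.\<close>

definition hIII_relations :: "complex \<Rightarrow> complex \<Rightarrow> complex \<Rightarrow> hgen free_alg set" where
  "hIII_relations q a b =
    {gen GX * gen GXi - 1,
     gen GXi * gen GX - 1,
     (gen GT1 + const (a * b)) * (gen GT1 + 1),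
     (gen GT0)\<^sup>2,
     (gen GT1 * gen GX + const a) * (gen GT1 * gen GX + const b),
     const q * gen GT0 * gen GXi + 1 - gen GX * gen GT0}"

definition hIII_ideal :: "complex \<Rightarrow> complex \<Rightarrow> complex \<Rightarrow> hgen free_alg set" where
  "hIII_ideal q a b = genideal free_alg_ring (hIII_relations q a b)"

definition hIII :: "complex \<Rightarrow> complex \<Rightarrow> complex \<Rightarrow> hgen free_alg set ring" where
  "hIII q a b = free_alg_ring Quot hIII_ideal q a b"

definition hIII_class :: "complex \<Rightarrow> complex \<Rightarrow> complex \<Rightarrow> hgen free_alg \<Rightarrow> hgen free_alg set" where
  "hIII_class q a b p = hIII_ideal q a b +>\<^bsub>free_alg_ring\<^esub> p"

definition hIII_scale ::
    "complex \<Rightarrow> complex \<Rightarrow> complex \<Rightarrow> complex \<Rightarrow> hgen free_alg set \<Rightarrow> hgen free_alg set" where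
  "hIII_scale q a b c x = hIII_class q a b (const c) \<otimes>\<^bsub>hIII q a b\<^esub> x"


section \<open>Laurent polynomials and their linear endomorphisms\<close>

text \<open>The function \<open>f\<close> represents the Laurent polynomial with coefficient \<open>f n\<close> at the \<open>n\<close>-th power
  of \<open>z\<close>.\<close>

type_synonym laurent = "int \<Rightarrow>\<^sub>0 complex"

definition laurent_scale :: "complex \<Rightarrow> laurent \<Rightarrow> laurent" where
  "laurent_scale c f = const c * f"

definition laurent_End :: "(laurent \<Rightarrow> laurent) ring" where
  "laurent_End =
    \<lparr>carrier = {F. Vector_Spaces.linear laurent_scale laurent_scale F},
     mult = (\<circ>), one = id, zero = (\<lambda>_. 0), add = (\<lambda>F G f. F f + G f)\<rparr>"

lemma vector_space_laurent_scale: "vector_space laurent_scale"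
  by unfold_locales
    (simp_all add: laurent_scale_def const_def distrib_left distrib_right single_add
      mult.assoc[symmetric] mult_single flip: single_one)

lemma ring_laurent_End: "ring laurent_End"
proof -
  interpret V: vector_space laurent_scale
    by (rule vector_space_laurent_scale)
  have lin: "Vector_Spaces.linear laurent_scale laurent_scale F \<longleftrightarrow>
      (\<forall>f g. F (f + g) = F f + F g) \<and> (\<forall>c f. F (laurent_scale c f) = laurent_scale c (F f))" for F
    unfolding Vector_Spaces.linear_iff
    by (simp add: V.vector_space_axioms)
  have neg: "\<exists>G. (\<forall>f g. G (f + g) = G f + G g) \<and>
      (\<forall>c f. G (laurent_scale c f) = laurent_scale c (G f)) \<and> (\<forall>f. F f + G f = 0)"
    if "\<forall>f g. F (f + g) = F f + F g" "\<forall>c f. F (laurent_scale c f) = laurent_scale c (F f)" for F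
    using that by (intro exI[of _ "\<lambda>f. - F f"]) simp
  show ?thesis
    by (intro ringI abelian_groupI monoidI)
      (auto simp: laurent_End_def fun_eq_iff lin add_ac V.scale_right_distrib neg)
qed

text \<open>
  The formulas for the operators involve division by \<open>q - z\<^sup>2\<close> and \<open>1 - z\<^sup>2\<close> and so are read in the
  field of rational functions in \<open>z\<close>: \<open>laurent_eval f w\<close> is \<open>f[w]\<close> for a rational function \<open>w\<close>,
  and \<open>f \<mapsto> f[z]\<close> embeds the Laurent polynomials into this field.
\<close>

type_synonym ratfun = "complex poly fract"

definition rat_const :: "complex \<Rightarrow> ratfun" where
  "rat_const c = to_fract [:c:]"

definition rat_z :: ratfun where
  "rat_z = to_fract [:0, 1:]"

definition laurent_eval :: "laurent \<Rightarrow> ratfun \<Rightarrow> ratfun" where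
  "laurent_eval f w = (\<Sum>n\<in>Poly_Mapping.keys f. rat_const (Poly_Mapping.lookup f n) * w powi n)"

definition T0_formula :: "complex \<Rightarrow> laurent \<Rightarrow> ratfun" where
  "T0_formula q f =
    - (rat_z / (rat_const q - rat_z\<^sup>2)) *
      (laurent_eval f rat_z - laurent_eval f (rat_const q * inverse rat_z))"

definition T1_formula :: "complex \<Rightarrow> complex \<Rightarrow> laurent \<Rightarrow> ratfun" where
  "T1_formula a b f =
    (rat_const (a + b) * rat_z - rat_const (1 + a * b)) / (1 - rat_z\<^sup>2) * laurent_eval f rat_z +
    (1 - rat_const a * rat_z) * (1 - rat_const b * rat_z) / (1 - rat_z\<^sup>2) *
      laurent_eval f (inverse rat_z)"


section \<open>Representations of \<open>\<H>\<^bsub>III\<^esub>\<close> on the Laurent polynomials\<close>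

definition hIII_representation ::
    "complex \<Rightarrow> complex \<Rightarrow> complex \<Rightarrow> (hgen free_alg set \<Rightarrow> laurent \<Rightarrow> laurent) \<Rightarrow> bool" where
  "hIII_representation q a b \<phi> \<longleftrightarrow>
    \<phi> \<in> ring_hom (hIII q a b) laurent_End \<and>
    (\<forall>c. \<forall>x\<in>carrier (hIII q a b). \<forall>f.
      \<phi> (hIII_scale q a b c x) f = laurent_scale c (\<phi> x f))"

end

theory Submission
  imports Defs "HOL-Analysis.Continuum_Not_Denumerable"
begin

text \<open>
  The formulas for \<open>T0\<close> and \<open>T1\<close> combine the value of \<open>f\<close> at \<open>z\<close> with its value at the reflected
  point \<open>q / z\<close> or \<open>1 / z\<close>. Evaluating at complex points instead of working with rational functions
  turns every statement about these operators into one about numbers: a Laurent polynomial is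
  determined by its values on any infinite set of nonzero points, and all but countably many points
  are \<open>generic\<close>: nowhere on their orbit under the two reflections does a denominator of the
  formulas or a coefficient of the reflected value vanish. The operators preserve the Laurent
  polynomials because the commutation relations with \<open>X\<close> compute the image of one monomial from the image of a
  neighbouring one, starting from the constant \<open>1\<close>. The defining relations then hold because they
  hold at generic points.

  For faithfulness, the relations allow every \<open>X\<close> to be moved to the left of every \<open>T0\<close> and \<open>T1\<close>,
  and they reduce words in \<open>T0\<close> and \<open>T1\<close> to alternating ones. So modulo the relations every element
  is a sum of terms \<open>p\<^sub>k(X) \<cdot> w\<^sub>k\<close>, where \<open>w\<^sub>k\<close> for an integer \<open>k\<close> is the alternating word of length
  \<open>\<bar>k\<bar>\<close> that starts with \<open>T0\<close> for \<open>k > 0\<close> and with \<open>T1\<close> for \<open>k < 0\<close> (\<open>normal_form_exists\<close>).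
  The two reflections generate a dihedral group, which is infinite since \<open>q\<close> is not a root of
  unity, and the orbit of a generic point \<open>z\<close> is free: its points are labelled by the integers in
  such a way that \<open>w\<^sub>k f\<close> evaluated at \<open>z\<close> is a nonzero multiple of the value of \<open>f\<close> at the \<open>k\<close>-th
  point plus contributions from points with label smaller in absolute value (\<open>leading_term\<close>).
  If a sum of normal forms acts as zero, take \<open>m\<close> with \<open>\<bar>m\<bar>\<close> maximal among its terms and apply the
  sum to an \<open>f\<close> that vanishes at every orbit point with label of absolute value at most \<open>\<bar>m\<bar>\<close>
  except the \<open>m\<close>-th. Only the term of \<open>m\<close> survives, so \<open>p\<^sub>m(z) = 0\<close> for all generic \<open>z\<close> and hence
  \<open>p\<^sub>m = 0\<close> (\<open>normal_forms_independent\<close>). Thus the ideal of relations is the whole kernel of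
  the action of the free algebra (\<open>kernel_rep\<close>).
\<close>

section \<open>Linear extension of maps on monomials\<close>

lemma poly_mapping_additive_induct [case_names zero single add]:
  fixes p :: "'m \<Rightarrow>\<^sub>0 'c::comm_monoid_add"
  assumes "P 0" "\<And>m x. P (Poly_Mapping.single m x)" "\<And>p r. P p \<Longrightarrow> P r \<Longrightarrow> P (p + r)"
  shows "P p"
proof (induction p rule: update_induct)
  case const
  show ?case by (fact assms(1))
next
  case (update p m x)
  have "Poly_Mapping.update m x p = p + Poly_Mapping.single m x"
    using update.hyps(1)
    by (intro poly_mapping_eqI) (auto simp: lookup_update lookup_add lookup_single when_def in_keys_iff)
  then show ?case
    using assms(2,3) update.IH by simp
qed

text \<open>
  The same sum extends the monomial images of an operator linearly, evaluates a Laurent polynomial,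
  lets the free algebra act, and assembles a normal form from its coefficients. The map \<open>c\<close> carries
  the coefficients, which need not be scalars, to the target.
\<close>

definition lin :: "('c::zero \<Rightarrow> 'r::semiring_0) \<Rightarrow> ('m \<Rightarrow> 'r) \<Rightarrow> ('m \<Rightarrow>\<^sub>0 'c) \<Rightarrow> 'r" where
  "lin c u p = (\<Sum>m\<in>Poly_Mapping.keys p. c (Poly_Mapping.lookup p m) * u m)"

locale additive_coeff =
  fixes c :: "'c::ab_group_add \<Rightarrow> 'r::ring"
  assumes c_add: "c (x + y) = c x + c y"
begin

lemma c_zero [simp]: "c 0 = 0"
  using c_add[of 0 0] by simp

lemma lin_superset:
  assumes "finite A" "Poly_Mapping.keys p \<subseteq> A"
  shows "lin c u p = (\<Sum>m\<in>A. c (Poly_Mapping.lookup p m) * u m)"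
  unfolding lin_def using assms by (intro sum.mono_neutral_left) (auto simp: in_keys_iff)

lemma lin_zero [simp]: "lin c u 0 = 0"
  by (simp add: lin_def)

lemma lin_single [simp]: "lin c u (Poly_Mapping.single m x) = c x * u m"
  by (subst lin_superset[of "{m}"]) auto

lemma lin_add: "lin c u (p + r) = lin c u p + lin c u r"
proof -
  let ?A = "Poly_Mapping.keys p \<union> Poly_Mapping.keys r"
  have "Poly_Mapping.keys (p + r) \<subseteq> ?A"
    by (rule keys_add)
  then show ?thesis
    by (simp add: lin_superset[of ?A] lookup_add c_add distrib_right sum.distrib)
qed

lemma lin_minus: "lin c u (p - r) = lin c u p - lin c u r"
  using lin_add[of u "p - r" r] by (simp add: algebra_simps)

end

lemma const_add: "const (x + y) = const x + const y"
  by (simp add: const_def single_add)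

lemma const_minus: "const (- x) = - const x"
  by (simp add: const_def single_uminus)

lemma const_mult: "const (x * y) = const x * const y"
  by (simp add: const_def mult_single)

lemma const_0 [simp]: "const 0 = 0" and const_1 [simp]: "const 1 = 1"
  by (simp_all add: const_def)

lemma const_times_single: "const x * Poly_Mapping.single m y = Poly_Mapping.single m (x * y)"
  by (simp add: const_def mult_single)

lemma const_commute:
  fixes p :: "'m::monoid_add \<Rightarrow>\<^sub>0 complex"
  shows "p * const x = const x * p"
  by (induction p rule: poly_mapping_additive_induct)
    (simp_all add: algebra_simps const_def mult_single)

interpretation const: additive_coeff const
  by unfold_locales (rule const_add)

lemma lin_const_scale: "lin const t (const x * p) = const x * lin const t p"
  by (induction p rule: poly_mapping_additive_induct)
    (simp_all add: const.lin_add distrib_left const_times_single const_mult mult.assoc)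

section \<open>Evaluating Laurent polynomials\<close>

text \<open>
  The coefficient map is a parameter so that the operator formulas are proved once for both the
  rational functions, where they are stated, and the complex numbers, where they are used.
\<close>

definition val :: "(complex \<Rightarrow> 'k) \<Rightarrow> 'k::field \<Rightarrow> laurent \<Rightarrow> 'k" where
  "val c w f = lin c (\<lambda>n. w powi n) f"

abbreviation zpow :: "int \<Rightarrow> laurent" where
  "zpow n \<equiv> Poly_Mapping.single n 1"

locale coeff_hom = additive_coeff c for c :: "complex \<Rightarrow> 'k::field" +
  assumes c_mult: "c (x * y) = c x * c y" and c_one [simp]: "c 1 = 1"
begin

lemma c_power: "c (x ^ n) = c x ^ n"
  by (induction n) (simp_all add: c_mult)

lemma c_inverse: "c (inverse x) = inverse (c x)"
proof (cases "x = 0")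
  case False
  then have "c x * c (inverse x) = 1" by (simp flip: c_mult)
  then show ?thesis by (metis inverse_unique)
qed simp

lemma c_powi: "c (x powi n) = c x powi n"
  by (simp add: power_int_def c_power c_inverse)

lemma val_add: "val c w (f + g) = val c w f + val c w g"
  by (simp add: val_def lin_add)

lemma val_minus: "val c w (f - g) = val c w f - val c w g"
  by (simp add: val_def lin_minus)

lemma val_uminus: "val c w (- f) = - val c w f"
  using val_minus[of w 0 f] by (simp add: val_def)

lemma val_zero [simp]: "val c w 0 = 0"
  by (simp add: val_def)

lemma val_single [simp]: "val c w (Poly_Mapping.single n x) = c x * w powi n"
  by (simp add: val_def)

lemma val_const [simp]: "val c w (const x) = c x"
  by (simp add: const_def)

lemma val_one [simp]: "val c w 1 = 1"
  by (simp flip: single_one)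

lemma val_mult: "w \<noteq> 0 \<Longrightarrow> val c w (f * g) = val c w f * val c w g"
proof (induction f rule: poly_mapping_additive_induct)
  case (single m x)
  show ?case
  proof (induction g rule: poly_mapping_additive_induct)
    case (single n y)
    have "w powi (m + n) = w powi m * w powi n"
      using \<open>w \<noteq> 0\<close> by (simp add: power_int_add)
    then show ?case by (simp add: mult_single c_mult)
  qed (simp_all add: distrib_left val_add)
qed (simp_all add: val_add distrib_right)

text \<open>A formula of the shape of those for \<open>T0\<close> and \<open>T1\<close> need only be checked on monomials.\<close>

lemma val_lin:
  assumes "w \<noteq> 0" "\<And>n. val c w (t n) = A * v powi n + B * v' powi n"
  shows "val c w (lin const t f) = A * val c v f + B * val c v' f"
  by (induction f rule: poly_mapping_additive_induct)
    (simp_all add: const.lin_add val_add val_mult assms algebra_simps)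

end

interpretation cpx: coeff_hom "id :: complex \<Rightarrow> complex"
  by unfold_locales simp_all

definition value_at :: "complex \<Rightarrow> laurent \<Rightarrow> complex" where
  "value_at = val id"

lemmas value_at_add = cpx.val_add[folded value_at_def]
  and value_at_minus = cpx.val_minus[folded value_at_def]
  and value_at_zero [simp] = cpx.val_zero[folded value_at_def]
  and value_at_one [simp] = cpx.val_one[folded value_at_def]
  and value_at_mult = cpx.val_mult[folded value_at_def]

lemma value_at_sum: "value_at w (sum h A) = (\<Sum>k\<in>A. value_at w (h k))"
  by (induction A rule: infinite_finite_induct) (simp_all add: value_at_add)

lemma value_at_single [simp]: "value_at w (Poly_Mapping.single n x) = x * w powi n"
  and value_at_const [simp]: "value_at w (const x) = x"
  unfolding value_at_def cpx.val_single cpx.val_const by (simp_all only: id_apply)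

lemma rat_const_add: "rat_const (x + y) = rat_const x + rat_const y"
proof -
  have "[:x + y:] = [:x:] + [:y:]" by simp
  then show ?thesis unfolding rat_const_def by (simp only: to_fract_add)
qed

lemma rat_const_mult: "rat_const (x * y) = rat_const x * rat_const y"
proof -
  have "[:x * y:] = [:x:] * [:y:]" by simp
  then show ?thesis unfolding rat_const_def by (simp only: to_fract_mult)
qed

lemma rat_const_1: "rat_const 1 = 1"
  unfolding rat_const_def one_pCons[symmetric] by (rule to_fract_1)

interpretation rat: coeff_hom rat_const
  by (intro coeff_hom.intro additive_coeff.intro coeff_hom_axioms.intro
    rat_const_add rat_const_mult rat_const_1)

lemma laurent_eval_eq_val: "laurent_eval f w = val rat_const w f"
  by (simp add: laurent_eval_def val_def lin_def)

lemma rat_z_nonzero: "rat_z \<noteq> 0"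
  by (simp add: rat_z_def)

lemma rat_const_minus_square_nonzero: "rat_const x - rat_z\<^sup>2 \<noteq> 0"
proof -
  have "rat_const x - rat_z\<^sup>2 = to_fract ([:x:] - [:0, 1:] * [:0,1:])"
    unfolding rat_const_def rat_z_def power2_eq_square to_fract_diff to_fract_mult ..
  then show ?thesis by simp
qed

text \<open>A power of \<open>z\<close> clears the negative exponents, and a polynomial has finitely many roots.\<close>

lemma laurent_eq_0_if_vanishes:
  assumes "infinite S" "\<And>w. w \<in> S \<Longrightarrow> w \<noteq> 0 \<and> value_at w f = 0"
  shows "f = 0"
proof -
  obtain N where N: "\<forall>n\<in>Poly_Mapping.keys f. N \<le> n"
    by (cases "Poly_Mapping.keys f = {}")
       (auto intro: that[of "Min (Poly_Mapping.keys f)"] that[of 0])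
  define p where "p = (\<Sum>n\<in>Poly_Mapping.keys f. monom (Poly_Mapping.lookup f n) (nat (n - N)))"
  have "poly p w = 0" if "w \<in> S" for w
  proof -
    have w: "w \<noteq> 0" "value_at w f = 0" using assms(2) that by auto
    have "poly p w = (\<Sum>n\<in>Poly_Mapping.keys f. w powi (- N) * (Poly_Mapping.lookup f n * w powi n))"
      unfolding p_def poly_sum
    proof (intro sum.cong refl)
      fix n assume "n \<in> Poly_Mapping.keys f"
      then have "N \<le> n" using N by auto
      then have "w ^ nat (n - N) = w powi (n + (- N))" by (simp add: power_int_def)
      also have "\<dots> = w powi n * w powi (- N)" using w by (intro power_int_add) simp
      finally have pow: "w ^ nat (n - N) = w powi n * w powi (- N)" .
      show "poly (monom (Poly_Mapping.lookup f n) (nat (n - N))) w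
          = w powi (- N) * (Poly_Mapping.lookup f n * w powi n)"
        by (simp add: poly_monom pow)
    qed
    also have "\<dots> = w powi (- N) * value_at w f"
      by (simp add: value_at_def val_def lin_def sum_distrib_left)
    finally show ?thesis using w by simp
  qed
  then have "S \<subseteq> {w. poly p w = 0}" by auto
  then have p0: "p = 0"
    using poly_roots_finite assms(1) finite_subset by blast
  have "Poly_Mapping.lookup f m = 0" for m
  proof (rule ccontr)
    assume "Poly_Mapping.lookup f m \<noteq> 0"
    then have m: "m \<in> Poly_Mapping.keys f" by (simp add: in_keys_iff)
    have "coeff p (nat (m - N)) = (\<Sum>n\<in>Poly_Mapping.keys f. if n = m then Poly_Mapping.lookup f n else 0)"
      unfolding p_def coeff_sum using N m by (intro sum.cong) (auto simp: nat_eq_iff)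
    then show False using m p0 by (simp add: in_keys_iff)
  qed
  then show ?thesis by (intro poly_mapping_eqI) simp
qed

lemma interpolation:
  assumes "finite S" "x \<notin> S" "x \<noteq> 0" "0 \<notin> S"
  shows "\<exists>f. (\<forall>y\<in>S. value_at y f = 0) \<and> value_at x f \<noteq> 0"
  using assms
proof (induction S)
  case empty
  then show ?case by (intro exI[of _ 1]) simp
next
  case (insert s S)
  then obtain f where "\<forall>y\<in>S. value_at y f = 0" "value_at x f \<noteq> 0" by auto
  moreover have "y \<noteq> 0" if "y \<in> insert s S" for y
    using that insert.prems by auto
  ultimately show ?case
    using insert.prems
    by (intro exI[of _ "(zpow 1 - const s) * f"]) (auto simp: value_at_mult value_at_minus)
qed

section \<open>The operators\<close>

text \<open>
  Here \<open>x\<close> is the variable, \<open>y\<close> its inverse, \<open>M\<close> a monomial and \<open>N * M'\<close> its reflection. The new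
  images are those dictated by \<open>T0 X = q X\<^sup>-\<^sup>1 T0 + 1\<close> and \<open>q T0 X\<^sup>-\<^sup>1 = X T0 - 1\<close>.
\<close>

lemma T0_monomial_step:
  fixes x y t M M' :: "'a::comm_ring_1"
  assumes xy: "x * y = 1" and PQ: "P * Q = 1" and t: "(Q - x * x) * t = - x * (M - N * M')"
  shows "(Q - x * x) * (Q * y * t + M) = - x * (x * M - Q * N * (y * M'))" (is ?up)
    and "(Q - x * x) * (P * (x * t - M)) = - x * (y * M - P * N * (x * M'))" (is ?down)
proof -
  have cancel: "x * (y * z) = z" "y * (x * z) = z" "P * (Q * z) = z" for z
    using xy PQ by (simp_all add: mult.assoc[symmetric] mult.commute[of y x])
  have e: "(Q - x * x) * (Q * y * t + M) = Q * y * ((Q - x * x) * t) + (Q - x * x) * M"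
    by (simp add: algebra_simps)
  show ?up unfolding e t by (simp add: algebra_simps xy cancel)
  have e: "(Q - x * x) * (P * (x * t - M)) = P * x * ((Q - x * x) * t) - P * ((Q - x * x) * M)"
    by (simp add: algebra_simps)
  show ?down unfolding e t by (simp add: algebra_simps xy PQ cancel)
qed

text \<open>
  The new images are those dictated by \<open>T1 X = X\<^sup>-\<^sup>1 (T1 + 1 + a b) - (a + b)\<close> and its counterpart
  for \<open>X\<^sup>-\<^sup>1\<close>, with \<open>c = 1 + a b\<close>, \<open>d = a + b\<close> and \<open>g = (1 - a x) (1 - b x)\<close>.
\<close>

lemma T1_monomial_step:
  fixes x y t M M' :: "'a::comm_ring_1"
  assumes xy: "x * y = 1" and t: "(1 - x * x) * t = (d * x - c) * M + g * M'"
  shows "(1 - x * x) * (y * (t + c * M) - d * M) = (d * x - c) * (x * M) + g * (y * M')" (is ?up)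
    and "(1 - x * x) * (x * t + d * M - c * y * M) = (d * x - c) * (y * M) + g * (x * M')" (is ?down)
proof -
  have cancel: "x * (y * z) = z" "y * (x * z) = z" for z
    using xy by (simp_all add: mult.assoc[symmetric] mult.commute[of y x])
  have e: "(1 - x * x) * (y * (t + c * M) - d * M)
      = y * ((1 - x * x) * t) + (1 - x * x) * (y * c * M - d * M)"
    by (simp add: algebra_simps)
  show ?up unfolding e t by (simp add: algebra_simps xy cancel)
  have e: "(1 - x * x) * (x * t + d * M - c * y * M)
      = x * ((1 - x * x) * t) + (1 - x * x) * (d * M - c * y * M)"
    by (simp add: algebra_simps)
  show ?down unfolding e t by (simp add: algebra_simps xy cancel)
qed

text \<open>This divisibility is what makes \<open>T0\<close> preserve the Laurent polynomials.\<close>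

lemma T0_monomial_exists:
  fixes q :: complex
  assumes q: "q \<noteq> 0"
  shows "\<exists>t. (const q - zpow 2) * t = - zpow 1 * (zpow n - const (q powi n) * zpow (- n))"
proof -
  have inv: "zpow 1 * zpow (-1) = 1" by (simp add: mult_single)
  have sq: "zpow 2 = zpow 1 * zpow 1" by (simp add: mult_single)
  have qi: "const (inverse q) * const q = (1::laurent)" using q by (simp flip: const_mult)
  show ?thesis
  proof (induction n rule: int_induct[of _ 0])
    case base
    show ?case by (intro exI[of _ 0]) simp
  next
    case (step1 n)
    then obtain t where
      t: "(const q - zpow 2) * t = - zpow 1 * (zpow n - const (q powi n) * zpow (- n))" by blast
    have e: "zpow (- (n + 1)) = zpow (-1) * zpow (- n)"
      "const (q powi (n + 1)) = const q * const (q powi n)" "zpow (n + 1) = zpow 1 * zpow n"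
      using q power_int_add_1'[of q n]
      by (simp_all add: mult_single add.commute[of _ 1] flip: const_mult)
    show ?case
      unfolding e using T0_monomial_step(1)[OF inv qi t[unfolded sq]] unfolding sq by blast
  next
    case (step2 n)
    then obtain t where
      t: "(const q - zpow 2) * t = - zpow 1 * (zpow n - const (q powi n) * zpow (- n))" by blast
    have e: "zpow (- (n - 1)) = zpow 1 * zpow (- n)"
      "const (q powi (n - 1)) = const (inverse q) * const (q powi n)"
      "zpow (n - 1) = zpow (-1) * zpow n"
      using q by (simp_all add: mult_single power_int_diff field_simps flip: const_mult)
    show ?case
      unfolding e using T0_monomial_step(2)[OF inv qi t[unfolded sq]] unfolding sq by blast
  qed
qed

lemma T1_monomial_exists:
  "\<exists>t. (1 - zpow 2) * t = (const (a + b) * zpow 1 - const (1 + a * b)) * zpow n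
      + (1 - const a * zpow 1) * (1 - const b * zpow 1) * zpow (- n)"
proof -
  have inv: "zpow 1 * zpow (-1) = 1" by (simp add: mult_single)
  have sq: "zpow 2 = zpow 1 * zpow 1" by (simp add: mult_single)
  show ?thesis
  proof (induction n rule: int_induct[of _ 0])
    case base
    have "zpow 0 = 1" "zpow (- 0) = 1" by simp_all
    then show ?case
      unfolding sq const_add const_mult const_1
      \<comment> \<open>constants are eigenvectors of \<open>T1\<close> with eigenvalue \<open>- a b\<close>\<close>
      by (intro exI[of _ "- const a * const b"])
        (simp only: \<open>zpow 0 = 1\<close> \<open>zpow (- 0) = 1\<close>, simp add: algebra_simps)
  next
    case (step1 n)
    then obtain t where
      t: "(1 - zpow 2) * t = (const (a + b) * zpow 1 - const (1 + a * b)) * zpow n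
        + (1 - const a * zpow 1) * (1 - const b * zpow 1) * zpow (- n)" by blast
    have e: "zpow (- (n + 1)) = zpow (-1) * zpow (- n)" "zpow (n + 1) = zpow 1 * zpow n"
      by (simp_all add: mult_single algebra_simps)
    show ?case
      unfolding e using T1_monomial_step(1)[OF inv t[unfolded sq]] unfolding sq by blast
  next
    case (step2 n)
    then obtain t where
      t: "(1 - zpow 2) * t = (const (a + b) * zpow 1 - const (1 + a * b)) * zpow n
        + (1 - const a * zpow 1) * (1 - const b * zpow 1) * zpow (- n)" by blast
    have e: "zpow (- (n - 1)) = zpow 1 * zpow (- n)" "zpow (n - 1) = zpow (-1) * zpow n"
      by (simp_all add: mult_single algebra_simps)
    show ?case
      unfolding e using T1_monomial_step(2)[OF inv t[unfolded sq]] unfolding sq by blast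
  qed
qed

locale hIII_parameters =
  fixes q a b :: complex
  assumes q_nonzero: "q \<noteq> 0" and a_nonzero: "a \<noteq> 0" and b_nonzero: "b \<noteq> 0"
    and q_no_root_of_unity: "\<And>m::nat. m \<ge> 1 \<Longrightarrow> q ^ m \<noteq> 1"
begin

definition T0_monomial :: "int \<Rightarrow> laurent" where
  "T0_monomial n = (SOME t. (const q - zpow 2) * t = - zpow 1 * (zpow n - const (q powi n) * zpow (- n)))"

definition T1_monomial :: "int \<Rightarrow> laurent" where
  "T1_monomial n = (SOME t. (1 - zpow 2) * t = (const (a + b) * zpow 1 - const (1 + a * b)) * zpow n
      + (1 - const a * zpow 1) * (1 - const b * zpow 1) * zpow (- n))"

lemma T0_monomial: "(const q - zpow 2) * T0_monomial n = - zpow 1 * (zpow n - const (q powi n) * zpow (- n))"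
  unfolding T0_monomial_def by (rule someI_ex[OF T0_monomial_exists[OF q_nonzero]])

lemma T1_monomial: "(1 - zpow 2) * T1_monomial n = (const (a + b) * zpow 1 - const (1 + a * b)) * zpow n
      + (1 - const a * zpow 1) * (1 - const b * zpow 1) * zpow (- n)"
  unfolding T1_monomial_def by (rule someI_ex[OF T1_monomial_exists])

definition T0 :: "laurent \<Rightarrow> laurent" where "T0 = lin const T0_monomial"
definition T1 :: "laurent \<Rightarrow> laurent" where "T1 = lin const T1_monomial"

lemma val_T0:
  assumes "coeff_hom c" and w: "w \<noteq> 0" and D: "c q - w\<^sup>2 \<noteq> 0"
  shows "val c w (T0 f) = - (w / (c q - w\<^sup>2)) * (val c w f - val c (c q / w) f)"
proof -
  interpret coeff_hom c by fact
  have "val c w (T0_monomial n) = - (w / (c q - w\<^sup>2)) * w powi n + w / (c q - w\<^sup>2) * (c q / w) powi n" for n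
  proof -
    have "val c w ((const q - zpow 2) * T0_monomial n)
        = val c w (- zpow 1 * (zpow n - const (q powi n) * zpow (- n)))"
      by (simp only: T0_monomial)
    then have "(c q - w\<^sup>2) * val c w (T0_monomial n) = - w * (w powi n - c q powi n * w powi (- n))"
      using w by (simp add: val_mult val_minus c_powi val_uminus)
    moreover have "(c q / w) powi n = c q powi n * w powi (- n)"
      by (simp add: power_int_divide_distrib power_int_minus field_simps)
    ultimately have "val c w (T0_monomial n) = - w * (w powi n - (c q / w) powi n) / (c q - w\<^sup>2)"
      by (simp only: nonzero_eq_divide_eq[OF D] mult.commute[of "c q - w\<^sup>2"])
    then show ?thesis
      by (simp add: right_diff_distrib diff_divide_distrib)
  qed
  from val_lin[OF w this, of f] show ?thesis
    by (simp add: T0_def algebra_simps)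
qed

lemma val_T1:
  assumes "coeff_hom c" and w: "w \<noteq> 0" and D: "1 - w\<^sup>2 \<noteq> 0"
  shows "val c w (T1 f) = (c (a + b) * w - c (1 + a * b)) / (1 - w\<^sup>2) * val c w f
     + (1 - c a * w) * (1 - c b * w) / (1 - w\<^sup>2) * val c (inverse w) f"
proof -
  interpret coeff_hom c by fact
  have "val c w (T1_monomial n) = (c (a + b) * w - c (1 + a * b)) / (1 - w\<^sup>2) * w powi n
     + (1 - c a * w) * (1 - c b * w) / (1 - w\<^sup>2) * inverse w powi n" for n
  proof -
    have "val c w ((1 - zpow 2) * T1_monomial n) =
        val c w ((const (a + b) * zpow 1 - const (1 + a * b)) * zpow n
          + (1 - const a * zpow 1) * (1 - const b * zpow 1) * zpow (- n))"
      by (simp only: T1_monomial)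
    then have "(1 - w\<^sup>2) * val c w (T1_monomial n) = (c (a + b) * w - c (1 + a * b)) * w powi n
        + (1 - c a * w) * (1 - c b * w) * inverse w powi n"
      using w by (simp add: val_mult val_minus val_add power_int_minus power_int_inverse)
    then have "val c w (T1_monomial n) = ((c (a + b) * w - c (1 + a * b)) * w powi n
        + (1 - c a * w) * (1 - c b * w) * inverse w powi n) / (1 - w\<^sup>2)"
      using D by (simp only: nonzero_eq_divide_eq[OF D] mult.commute[of "1 - w\<^sup>2"])
    then show ?thesis
      by (simp add: add_divide_distrib)
  qed
  from val_lin[OF w this, of f] show ?thesis
    by (simp add: T1_def)
qed

lemma T0_add: "T0 (f + g) = T0 f + T0 g" and T1_add: "T1 (f + g) = T1 f + T1 g"
  by (simp_all add: T0_def T1_def const.lin_add)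

lemma T0_scale: "T0 (const x * f) = const x * T0 f" and T1_scale: "T1 (const x * f) = const x * T1 f"
  by (simp_all add: T0_def T1_def lin_const_scale)

section \<open>The action of the free algebra\<close>

fun act :: "hgen \<Rightarrow> laurent \<Rightarrow> laurent" where
  "act GT0 f = T0 f"
| "act GT1 f = T1 f"
| "act GX f = zpow 1 * f"
| "act GXi f = zpow (-1) * f"

lemma act_add: "act g (f + h) = act g f + act g h"
  by (cases g) (simp_all add: T0_add T1_add distrib_left)

lemma act_scale: "act g (const x * f) = const x * act g f"
  by (cases g) (simp_all add: T0_scale T1_scale mult.left_commute)

definition act_word :: "hgen free_monoid \<Rightarrow> laurent \<Rightarrow> laurent" where
  "act_word w f = foldr act (letters w) f"

lemma act_word_zero [simp]: "act_word 0 f = f"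
  by (simp add: act_word_def zero_free_monoid_def)

lemma act_word_plus: "act_word (v + w) f = act_word v (act_word w f)"
  by (simp add: act_word_def plus_free_monoid_def)

lemma act_word_add: "act_word w (f + g) = act_word w f + act_word w g"
proof -
  have "foldr act ls (f + g) = foldr act ls f + foldr act ls g" for ls
    by (induction ls) (simp_all add: act_add)
  then show ?thesis by (simp add: act_word_def)
qed

lemma act_word_scale: "act_word w (const x * f) = const x * act_word w f"
proof -
  have "foldr act ls (const x * f) = const x * foldr act ls f" for ls
    by (induction ls) (simp_all add: act_scale)
  then show ?thesis by (simp add: act_word_def)
qed

definition rep :: "hgen free_alg \<Rightarrow> laurent \<Rightarrow> laurent" where
  "rep p f = lin const (\<lambda>w. act_word w f) p"

lemma rep_add: "rep (p + r) f = rep p f + rep r f"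
  by (simp add: rep_def const.lin_add)

lemma rep_minus: "rep (p - r) f = rep p f - rep r f"
  by (simp add: rep_def const.lin_minus)

lemma rep_zero [simp]: "rep 0 f = 0"
  by (simp add: rep_def)

lemma rep_single: "rep (Poly_Mapping.single w x) f = const x * act_word w f"
  by (simp add: rep_def)

lemma rep_const [simp]: "rep (const x) f = const x * f"
  by (subst const_def) (simp add: rep_single)

lemma rep_one [simp]: "rep 1 f = f"
  using rep_const[of 1 f] by simp

lemma rep_gen [simp]: "rep (gen g) f = act g f"
  by (simp add: gen_def rep_single act_word_def)

lemma rep_vector_add: "rep p (f + g) = rep p f + rep p g"
  by (induction p rule: poly_mapping_additive_induct)
    (simp_all add: rep_add rep_single act_word_add distrib_left)

lemma rep_vector_scale: "rep p (const x * f) = const x * rep p f"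
  by (induction p rule: poly_mapping_additive_induct)
    (simp_all add: rep_add rep_single act_word_scale distrib_left mult.left_commute)

lemma rep_vector_zero [simp]: "rep p 0 = 0"
  using rep_vector_scale[of p 0 0] by simp

lemma rep_mult: "rep (p * r) f = rep p (rep r f)"
proof (induction p rule: poly_mapping_additive_induct)
  case (single v x)
  show ?case
  proof (induction r rule: poly_mapping_additive_induct)
    case (single w y)
    show ?case
      by (simp add: mult_single rep_single act_word_plus act_word_scale const_mult mult.assoc)
  next
    case (add r s)
    then show ?case by (simp add: distrib_left rep_add rep_vector_add)
  qed simp
qed (simp_all add: rep_add distrib_right)

section \<open>Generic points of the dihedral action\<close>

text \<open>
  The orbit of \<open>z\<close> under \<open>z \<mapsto> q / z\<close> and \<open>z \<mapsto> 1 / z\<close>, labelled by the integers so that replacing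
  the base point \<open>z\<close> by \<open>q / z\<close> or \<open>1 / z\<close> amounts to \<open>k \<mapsto> 1 - k\<close> or \<open>k \<mapsto> - 1 - k\<close>. These are also the rules by which
  prepending a letter changes the label of an alternating word in \<open>T0\<close> and \<open>T1\<close>.
\<close>

definition orbit :: "int \<Rightarrow> complex \<Rightarrow> complex" where
  "orbit k z = (if even k then q powi (- (k div 2)) * z else q powi (k div 2 + 1) / z)"

text \<open>
  The conditions keep away from the poles of the operators and the zeros of the coefficients
  of the reflected value in \<open>T1\<close>. They range over the whole orbit, so they are inherited by the
  reflected points; the first two also exclude fixed points of reflections, which makes the orbit
  free.
\<close>

definition generic :: "complex \<Rightarrow> bool" where
  "generic z \<longleftrightarrow> z \<noteq> 0 \<and>
    (\<forall>k. (orbit k z)\<^sup>2 \<noteq> 1 \<and> (orbit k z)\<^sup>2 \<noteq> q \<and> a * orbit k z \<noteq> 1 \<and> b * orbit k z \<noteq> 1)"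

lemma orbit_0 [simp]: "orbit 0 z = z"
  by (simp add: orbit_def)

lemma orbit_even: "orbit (2 * j) z = q powi (- j) * z"
  and orbit_odd: "orbit (2 * j + 1) z = q powi (j + 1) / z"
  by (simp_all add: orbit_def)

lemma orbit_T0: "z \<noteq> 0 \<Longrightarrow> orbit k (q / z) = orbit (1 - k) z"
proof (cases "even k")
  case True
  then obtain j where k: "k = 2 * j" by (elim evenE)
  have r: "1 - k = 2 * (- j) + 1" using k by simp
  show "orbit k (q / z) = orbit (1 - k) z"
    unfolding r orbit_odd unfolding k orbit_even using q_nonzero power_int_add_1[of q "- j"] by (simp add: mult.commute)
next
  case False
  then obtain j where k: "k = 2 * j + 1" by (elim oddE)
  have r: "1 - k = 2 * (- j)" using k by simp
  show "orbit k (q / z) = orbit (1 - k) z"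
    unfolding r orbit_even unfolding k orbit_odd using q_nonzero by (simp add: power_int_add_1)
qed

lemma orbit_T1: "z \<noteq> 0 \<Longrightarrow> orbit k (inverse z) = orbit (- 1 - k) z"
proof (cases "even k")
  case True
  then obtain j where k: "k = 2 * j" by (elim evenE)
  have r: "- 1 - k = 2 * (- j - 1) + 1" using k by simp
  show "orbit k (inverse z) = orbit (- 1 - k) z"
    unfolding r orbit_odd unfolding k orbit_even by (simp add: field_simps)
next
  case False
  then obtain j where k: "k = 2 * j + 1" by (elim oddE)
  have r: "- 1 - k = 2 * (- j - 1)" using k by simp
  show "orbit k (inverse z) = orbit (- 1 - k) z"
    unfolding r orbit_even unfolding k orbit_odd by (simp add: field_simps)
qed

lemma orbit_nonzero: "z \<noteq> 0 \<Longrightarrow> orbit k z \<noteq> 0"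
  using q_nonzero by (simp add: orbit_def)

lemma generic_T0: "generic z \<Longrightarrow> generic (q / z)"
  using q_nonzero by (auto simp: generic_def orbit_T0)

lemma generic_T1: "generic z \<Longrightarrow> generic (inverse z)"
  by (auto simp: generic_def orbit_T1)

lemma genericD:
  assumes "generic z"
  shows "z \<noteq> 0" "z\<^sup>2 \<noteq> 1" "z\<^sup>2 \<noteq> q" "a * z \<noteq> 1" "b * z \<noteq> 1"
  using assms unfolding generic_def by (metis orbit_0)+

lemma q_powi_inj: "q powi m = 1 \<Longrightarrow> m = 0"
  using q_no_root_of_unity[of "nat m"] q_no_root_of_unity[of "nat (- m)"]
  by (cases "m > 0"; cases "m < 0") (auto simp: power_int_def power_inverse)

text \<open>
  A coincidence between labels of equal parity makes a power of \<open>q\<close> equal to one. Labels of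
  different parity are related by a reflection in the dihedral group; its fixed points are
  moved by the group to fixed points of \<open>z \<mapsto> 1 / z\<close> or \<open>z \<mapsto> q / z\<close>, whose squares are \<open>1\<close> or \<open>q\<close>.
\<close>

lemma orbit_inj:
  assumes "generic z" "orbit j z = orbit k z"
  shows "j = k"
proof -
  have z: "z \<noteq> 0" using assms by (simp add: generic_def)
  have mixed: False if par: "even j" "odd k" and eq: "orbit j z = orbit k z" for j k
  proof -
    obtain m n where m: "j = 2 * m" "k = 2 * n + 1" using par by (elim evenE oddE)
    define s where "s = m + n + 1"
    have "q powi (- m) * z = q powi (n + 1) / z"
      using eq unfolding m orbit_even orbit_odd .
    then have "q powi m * (q powi (- m) * z) * z = q powi m * (q powi (n + 1) / z) * z"
      by simp
    then have z2: "z\<^sup>2 = q powi s"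
      using z q_nonzero by (simp add: s_def power_int_add power_int_minus power2_eq_square field_simps)
    obtain l where l: "s = 2 * l \<or> s = 2 * l + 1"
      by (metis evenE oddE)
    have "(orbit (2 * l) z)\<^sup>2 = q powi (- l) * q powi (- l) * q powi s"
      unfolding orbit_even z2[symmetric] by (simp add: power2_eq_square)
    also have "\<dots> = q powi (- l + - l + s)"
      using q_nonzero by (simp only: power_int_add simp_thms)
    finally have "(orbit (2 * l) z)\<^sup>2 = 1 \<or> (orbit (2 * l) z)\<^sup>2 = q"
      using l by auto
    then show False using assms(1) unfolding generic_def by blast
  qed
  show ?thesis
  proof (cases "even j = even k")
    case True
    then have "q powi (k div 2 - j div 2) = 1"
      using assms(2) z q_nonzero
      by (auto simp: orbit_def power_int_diff power_int_minus power_int_add split: if_splits)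
    then have "k div 2 = j div 2" using q_powi_inj by fastforce
    then show ?thesis using True by presburger
  next
    case False
    then show ?thesis using mixed[of j k] mixed[of k j] assms(2) by metis
  qed
qed

text \<open>Only countably many points have one of the finitely many forbidden values on their orbit.\<close>

lemma infinite_generic: "infinite {z. generic z}"
proof -
  define B where "B = {w. w = 0 \<or> w\<^sup>2 = 1 \<or> w\<^sup>2 = q \<or> a * w = 1 \<or> b * w = 1}"
  have sq: "finite {w::complex. w\<^sup>2 = c}" for c
  proof -
    have "finite {w. poly ([:0, 0, 1:] - [:c:]) w = 0}"
      by (rule poly_roots_finite) simp
    moreover have "{w. poly ([:0, 0, 1:] - [:c:]) w = 0} = {w. w\<^sup>2 = c}"
      by (auto simp: power2_eq_square)
    ultimately show ?thesis by simp
  qed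
  have "B \<subseteq> {0} \<union> {w. w\<^sup>2 = 1} \<union> {w. w\<^sup>2 = q} \<union> {1 / a} \<union> {1 / b}"
    using a_nonzero b_nonzero by (auto simp: B_def field_simps)
  then have "finite B" using sq by (meson finite.emptyI finite.insertI finite_UnI finite_subset)
  have "inj (orbit k)" for k
    using q_nonzero by (auto simp: inj_def orbit_def field_simps)
  then have "countable (\<Union>k. orbit k -` B)"
    using \<open>finite B\<close> by (intro countable_UN countable_finite[OF finite_vimageI]) auto
  moreover have "- {z. generic z} \<subseteq> (\<Union>k. orbit k -` B)"
  proof
    fix z assume "z \<in> - {z. generic z}"
    then obtain k where "z = 0 \<or> orbit k z \<in> B" by (auto simp: generic_def B_def)
    then show "z \<in> (\<Union>k. orbit k -` B)"
      using orbit_0[of 0] by (auto simp: B_def simp del: orbit_0)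
  qed
  ultimately have "countable (- {z. generic z})" by (rule countable_subset[rotated])
  then show ?thesis
    using uncountable_UNIV_complex countable_finite
    by (metis Compl_partition countable_Un_iff)
qed

lemma eq_if_eq_at_generic:
  assumes "\<And>z. generic z \<Longrightarrow> value_at z f = value_at z g"
  shows "f = g"
proof -
  have "f - g = 0"
    using assms by (intro laurent_eq_0_if_vanishes[OF infinite_generic])
      (auto simp: value_at_minus generic_def)
  then show ?thesis by simp
qed

lemma T0_at:
  assumes "z \<noteq> 0" "z\<^sup>2 \<noteq> q"
  shows "value_at z (T0 f) = - (z / (q - z\<^sup>2)) * (value_at z f - value_at (q / z) f)"
  using val_T0[OF cpx.coeff_hom_axioms, of z f] assms unfolding value_at_def by simp

lemma T1_at:
  assumes "z \<noteq> 0" "z\<^sup>2 \<noteq> 1"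
  shows "value_at z (T1 f) = ((a + b) * z - (1 + a * b)) / (1 - z\<^sup>2) * value_at z f
     + (1 - a * z) * (1 - b * z) / (1 - z\<^sup>2) * value_at (inverse z) f"
  using val_T1[OF cpx.coeff_hom_axioms, of z f] assms unfolding value_at_def by simp

section \<open>The defining relations hold\<close>

text \<open>
  Both \<open>f[z] - f[q / z]\<close> and its coefficient change sign under \<open>z \<mapsto> q / z\<close>. As \<open>T0\<close> kills
  invariant functions, its square is zero.
\<close>

lemma T0_invariant:
  assumes "generic z"
  shows "value_at (q / z) (T0 f) = value_at z (T0 f)"
proof -
  note z = genericD[OF assms] and z' = genericD[OF generic_T0[OF assms]]
  define c where "c = z / (q - z\<^sup>2)"
  have D: "q / z / (q - (q / z)\<^sup>2) = - c"
    using z z' q_nonzero by (simp add: c_def divide_simps power2_eq_square) (simp add: algebra_simps)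
  have e: "q / (q / z) = z" using z q_nonzero by simp
  show ?thesis
    unfolding T0_at[OF z(1,3)] T0_at[OF z'(1,3)] D e c_def[symmetric] by (simp add: algebra_simps)
qed

lemma T0_T0: "T0 (T0 f) = 0"
  by (rule eq_if_eq_at_generic) (simp add: T0_at genericD T0_invariant)

lemma X_T0: "const q * T0 (zpow (-1) * f) + f = zpow 1 * T0 f"
proof (rule eq_if_eq_at_generic)
  fix z assume "generic z"
  note z = genericD[OF this]
  have D: "q - z\<^sup>2 \<noteq> 0" using z by simp
  show "value_at z (const q * T0 (zpow (-1) * f) + f) = value_at z (zpow 1 * T0 f)"
    using z q_nonzero D
    by (simp add: value_at_add value_at_mult T0_at)
      (simp add: divide_simps, simp add: algebra_simps power2_eq_square)
qed

text \<open>
  With \<open>s\<close> denoting the reflection \<open>z \<mapsto> 1 / z\<close>, the operator is \<open>T1 = - a b + g (s - 1)\<close> for this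
  coefficient \<open>g\<close>. Since \<open>(s - 1) g (s - 1) = - (g + s g) (s - 1)\<close>, the quadratic relation of \<open>T1\<close>
  comes down to \<open>g + s g = 1 - a b\<close>.
\<close>

definition T1_coeff :: "complex \<Rightarrow> complex" where
  "T1_coeff z = (1 - a * z) * (1 - b * z) / (1 - z\<^sup>2)"

lemma T1_coeff_sum:
  assumes "z \<noteq> 0" "z\<^sup>2 \<noteq> 1"
  shows "T1_coeff z + T1_coeff (inverse z) = 1 - a * b"
proof -
  have D: "1 - z\<^sup>2 \<noteq> 0" "z\<^sup>2 - 1 \<noteq> 0" using assms by auto
  have "T1_coeff (inverse z) = - ((z - a) * (z - b) / (1 - z\<^sup>2))"
    unfolding T1_coeff_def using assms D by (simp add: divide_simps power2_eq_square) (simp add: algebra_simps)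
  then have "T1_coeff z + T1_coeff (inverse z) = ((1 - a * z) * (1 - b * z) - (z - a) * (z - b)) / (1 - z\<^sup>2)"
    by (simp add: T1_coeff_def diff_divide_distrib)
  also have "(1 - a * z) * (1 - b * z) - (z - a) * (z - b) = (1 - a * b) * (1 - z\<^sup>2)"
    by (simp add: algebra_simps power2_eq_square)
  finally show ?thesis using D by simp
qed

lemma T1_at_eigen:
  assumes "z \<noteq> 0" "z\<^sup>2 \<noteq> 1"
  shows "value_at z (T1 f) = - (a * b) * value_at z f + T1_coeff z * (value_at (inverse z) f - value_at z f)"
proof -
  have D: "1 - z\<^sup>2 \<noteq> 0" using assms by auto
  have e: "((a + b) * z - (1 + a * b)) / (1 - z\<^sup>2) = - (a * b) - T1_coeff z"
    unfolding T1_coeff_def using D by (simp add: divide_simps) (simp add: algebra_simps power2_eq_square)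
  show ?thesis
    unfolding T1_at[OF assms] T1_coeff_def[symmetric] e by (simp add: algebra_simps)
qed

lemma T1_quadratic: "T1 (T1 f + f) + const (a * b) * (T1 f + f) = 0"
proof (rule eq_if_eq_at_generic)
  fix z assume gz: "generic z"
  note z = genericD[OF gz] and z' = genericD[OF generic_T1[OF gz]]
  have s: "T1_coeff (inverse z) = 1 - a * b - T1_coeff z" using T1_coeff_sum[OF z(1,2)] by (simp add: algebra_simps)
  show "value_at z (T1 (T1 f + f) + const (a * b) * (T1 f + f)) = value_at z 0"
    using z z' by (simp add: value_at_add value_at_mult T1_at_eigen s) (simp add: algebra_simps)
qed

text \<open>
  Writing \<open>T1 X = h + k s\<close> with functions \<open>h\<close> and \<open>k\<close> of \<open>z\<close>, the product
  \<open>(T1 X + a) (T1 X + b)\<close> vanishes once its coefficients of \<open>1\<close> and of \<open>s\<close> do; below, \<open>coeff_F\<close> and \<open>coeff_G\<close> are these two identities, up to a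
  factor in the second.
\<close>

lemma T1_X_quadratic:
  "T1 (zpow 1 * (T1 (zpow 1 * f) + const b * f)) + const a * (T1 (zpow 1 * f) + const b * f) = 0"
proof (rule eq_if_eq_at_generic)
  fix z assume gz: "generic z"
  note z = genericD[OF gz] and z' = genericD[OF generic_T1[OF gz]]
  have s: "T1_coeff (inverse z) = 1 - a * b - T1_coeff z" using T1_coeff_sum[OF z(1,2)] by (simp add: algebra_simps)
  have D: "1 - z\<^sup>2 \<noteq> 0" using z by auto
  have g: "T1_coeff z * (1 - z * z) = (1 - a * z) * (1 - b * z)"
    unfolding T1_coeff_def using D by (simp add: power2_eq_square)
  define F where "F = value_at z f"
  define G where "G = value_at (inverse z) f"
  define w where "w = inverse z"
  have zw: "z * w = 1" "w * z = 1" using z by (simp_all add: w_def)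
  define A where "A = value_at z (T1 (zpow 1 * f) + const b * f)"
  define B where "B = value_at w (T1 (zpow 1 * f) + const b * f)"
  have A: "A = - (a * b) * (z * F) + T1_coeff z * (w * G - z * F) + b * F"
    using z z' by (simp add: A_def value_at_add value_at_mult T1_at_eigen F_def G_def w_def)
  have B: "B = - (a * b) * (w * G) + (1 - a * b - T1_coeff z) * (z * F - w * G) + b * G"
    using z z' by (simp add: B_def value_at_add value_at_mult T1_at_eigen F_def G_def w_def s[unfolded w_def])
  have "z * ((- (a * b) - T1_coeff z) * z + a + (T1_coeff z - 1) * w + b) = 0"
  proof -
    have "z * ((- (a * b) - T1_coeff z) * z + a + (T1_coeff z - 1) * w + b)
        = T1_coeff z * (1 - z * z) - a * b * z * z + (a + b) * z - 1 + (T1_coeff z - 1) * (z * w - 1)"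
      by (simp add: algebra_simps)
    then show ?thesis unfolding g zw by (simp add: algebra_simps)
  qed
  then have coeff_G: "(- (a * b) - T1_coeff z) * z + a + (T1_coeff z - 1) * w + b = 0"
    using z by simp
  have coeff_F: "((- (a * b) - T1_coeff z) * z + a) * ((- (a * b) - T1_coeff z) * z + b)
      + T1_coeff z * (1 - a * b - T1_coeff z) = 0"
  proof -
    have "((- (a * b) - T1_coeff z) * z + a) * ((- (a * b) - T1_coeff z) * z + b) + T1_coeff z * (1 - a * b - T1_coeff z)
        = (a * b + T1_coeff z) * ((1 - a * z) * (1 - b * z) - T1_coeff z * (1 - z * z))"
      by (simp add: algebra_simps)
    then show ?thesis unfolding g by simp
  qed
  have "- (a * b) * (z * A) + T1_coeff z * (w * B - z * A) + a * A
      = (((- (a * b) - T1_coeff z) * z + a) * ((- (a * b) - T1_coeff z) * z + b)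
          + T1_coeff z * (1 - a * b - T1_coeff z)) * F
        + T1_coeff z * w * ((- (a * b) - T1_coeff z) * z + a + (T1_coeff z - 1) * w + b) * G"
  proof -
    have e1: "T1_coeff z * (w * B) = T1_coeff z * w * ((T1_coeff z - 1) * w + b) * G
        + T1_coeff z * (1 - a * b - T1_coeff z) * (w * z) * F"
      unfolding B by (simp add: algebra_simps)
    have e2: "(a - (a * b + T1_coeff z) * z) * A
        = ((- (a * b) - T1_coeff z) * z + a) * (((- (a * b) - T1_coeff z) * z + b) * F + T1_coeff z * w * G)"
      unfolding A by (simp add: algebra_simps)
    have "- (a * b) * (z * A) + T1_coeff z * (w * B - z * A) + a * A
        = (a - (a * b + T1_coeff z) * z) * A + T1_coeff z * (w * B)"
      by (simp add: algebra_simps)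
    then show ?thesis unfolding e1 e2 zw by (simp add: algebra_simps)
  qed
  then have "- (a * b) * (z * A) + T1_coeff z * (w * B - z * A) + a * A = 0"
    unfolding coeff_F coeff_G by simp
  then show "value_at z (T1 (zpow 1 * (T1 (zpow 1 * f) + const b * f))
      + const a * (T1 (zpow 1 * f) + const b * f)) = value_at z 0"
    using z z' by (simp add: value_at_add value_at_mult T1_at_eigen A_def B_def w_def)
qed

lemma rep_relations: "p \<in> hIII_relations q a b \<Longrightarrow> rep p f = 0"
proof -
  have inv: "zpow 1 * (zpow (-1) * f) = f" "zpow (-1) * (zpow 1 * f) = f" for f
    by (simp_all add: mult.assoc[symmetric] mult_single)
  show "p \<in> hIII_relations q a b \<Longrightarrow> rep p f = 0"
    unfolding hIII_relations_def
    using T0_T0 X_T0[of f] T1_quadratic[of f] T1_X_quadratic[of f]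
    by (auto simp: rep_add rep_minus rep_mult inv power2_eq_square mult.assoc)
qed

section \<open>Commutation rules modulo the relations\<close>

abbreviation I :: "hgen free_alg set" where "I \<equiv> hIII_ideal q a b"

lemma ideal_I: "ideal I free_alg_ring"
  unfolding hIII_ideal_def
  by (intro ring.genideal_ideal ring_free_alg_ring) (simp add: free_alg_ring_def)

lemma I_relation: "p \<in> hIII_relations q a b \<Longrightarrow> p \<in> I"
  using ring.genideal_self[OF ring_free_alg_ring, of "hIII_relations q a b"]
  by (auto simp: hIII_ideal_def free_alg_ring_def)

lemma I_zero [simp]: "0 \<in> I"
  using additive_subgroup.zero_closed[OF ideal.axioms(1)[OF ideal_I]] by (simp add: free_alg_ring_def)

lemma I_add: "x \<in> I \<Longrightarrow> y \<in> I \<Longrightarrow> x + y \<in> I"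
  using additive_subgroup.a_closed[OF ideal.axioms(1)[OF ideal_I]] by (simp add: free_alg_ring_def)

lemma I_left: "x \<in> I \<Longrightarrow> p * x \<in> I" and I_right: "x \<in> I \<Longrightarrow> x * p \<in> I"
  using ideal.I_l_closed[OF ideal_I, of x p] ideal.I_r_closed[OF ideal_I, of x p]
  by (simp_all add: free_alg_ring_def)

lemma I_uminus: "x \<in> I \<Longrightarrow> - x \<in> I"
  using I_left[of x "- 1"] by simp

lemma I_minus: "x \<in> I \<Longrightarrow> y \<in> I \<Longrightarrow> x - y \<in> I"
  using I_add[of x "- y"] I_uminus[of y] by simp

definition cong_I :: "hgen free_alg \<Rightarrow> hgen free_alg \<Rightarrow> bool" (infix "\<doteq>" 50) where
  "x \<doteq> y \<longleftrightarrow> x - y \<in> I"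

lemma const_left_commute:
  fixes p r :: "'m::monoid_add \<Rightarrow>\<^sub>0 complex"
  shows "p * (const x * r) = const x * (p * r)"
  by (simp add: const_commute flip: mult.assoc)

lemma const_const_mult:
  fixes r :: "'m::monoid_add \<Rightarrow>\<^sub>0 complex"
  shows "const x * (const y * r) = const (x * y) * r"
  by (simp add: const_mult mult.assoc)

lemmas const_simps = const_commute[of "gen g" for g] const_left_commute[of "gen g" for g]
  const_const_mult const_mult[symmetric]

lemma cong_X_Xi: "gen GX * gen GXi \<doteq> 1" and cong_Xi_X: "gen GXi * gen GX \<doteq> 1"
  unfolding cong_I_def by (auto intro!: I_relation simp: hIII_relations_def)

lemma cong_T0_T0: "gen GT0 * gen GT0 \<doteq> 0"
  unfolding cong_I_def by (auto intro!: I_relation simp: hIII_relations_def power2_eq_square)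

lemma cong_T1_T1: "gen GT1 * gen GT1 \<doteq> - const (1 + a * b) * gen GT1 - const (a * b)"
proof -
  have "(gen GT1 + const (a * b)) * (gen GT1 + 1) \<in> I"
    by (auto intro!: I_relation simp: hIII_relations_def)
  then show ?thesis
    by (simp add: cong_I_def algebra_simps const_add)
qed

text \<open>
  The second congruence is the defining relation multiplied by \<open>X\<^sup>-\<^sup>1\<close> on the left and \<open>X\<close> on the
  right. In the free algebra \<open>X\<close> and \<open>X\<^sup>-\<^sup>1\<close> cancel only modulo the ideal, whence the correction
  terms with \<open>?E\<close>.
\<close>

lemma cong_T0_Xi: "gen GT0 * gen GXi \<doteq> const (inverse q) * (gen GX * gen GT0 - 1)"
  and cong_T0_X: "gen GT0 * gen GX \<doteq> const q * gen GXi * gen GT0 + 1"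
proof -
  let ?R = "const q * gen GT0 * gen GXi + 1 - gen GX * gen GT0"
  have R: "?R \<in> I"
    by (auto intro!: I_relation simp: hIII_relations_def)
  have "gen GT0 * gen GXi - const (inverse q) * (gen GX * gen GT0 - 1) = const (inverse q) * ?R"
    using q_nonzero by (simp add: algebra_simps const_simps)
  then show "gen GT0 * gen GXi \<doteq> const (inverse q) * (gen GX * gen GT0 - 1)"
    unfolding cong_I_def using I_left[OF R] by simp
  let ?E = "gen GXi * gen GX - 1"
  have E: "?E \<in> I" using cong_Xi_X by (simp add: cong_I_def)
  have "gen GT0 * gen GX - (const q * gen GXi * gen GT0 + 1)
      = (const q * gen GXi * gen GT0 * ?E + ?E) - (?E * (gen GT0 * gen GX) + gen GXi * ?R * gen GX)"
    by (simp add: algebra_simps const_simps)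
  also have "\<dots> \<in> I"
    by (intro I_add I_minus I_left[OF E] I_right[OF E] E I_right[OF I_left[OF R]])
  finally show "gen GT0 * gen GX \<doteq> const q * gen GXi * gen GT0 + 1"
    unfolding cong_I_def .
qed

text \<open>
  With \<open>S = T1 + 1 + a b\<close> the quadratic relation reads \<open>S T1 = - a b\<close>, so that \<open>T1\<close> is invertible
  because \<open>a b \<noteq> 0\<close>. Multiplying \<open>(T1 X + a) (T1 X + b) = 0\<close> by \<open>S\<close> on the left and dividing by
  \<open>- a b\<close> gives \<open>X T1 X + (a + b) X = S\<close>. Multiplying this by \<open>X\<^sup>-\<^sup>1\<close> on either side yields the two
  rules.
\<close>

lemma cong_T1_X: "gen GT1 * gen GX \<doteq> gen GXi * (gen GT1 + const (1 + a * b)) - const (a + b)"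
  and cong_T1_Xi: "gen GT1 * gen GXi \<doteq> gen GX * gen GT1 + const (a + b) - const (1 + a * b) * gen GXi"
proof -
  let ?R1 = "(gen GT1 + const (a * b)) * (gen GT1 + 1)"
  let ?R2 = "(gen GT1 * gen GX + const a) * (gen GT1 * gen GX + const b)"
  let ?S = "gen GT1 + const (1 + a * b)"
  let ?V = "gen GX * gen GT1 * gen GX + const (a + b) * gen GX"
  have R: "?R1 \<in> I" "?R2 \<in> I"
    by (auto intro!: I_relation simp: hIII_relations_def)
  have unit: "inverse (a * b) * (a * b) = 1" using a_nonzero b_nonzero by (intro left_inverse) simp
  have "?V - ?S = const (inverse (a * b)) * (const (a * b) * (?V - ?S))"
    by (simp only: const_const_mult unit const_1 mult_1_left)
  also have "const (a * b) * (?V - ?S) = ?R1 * ?V - ?S * ?R2"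
    by (simp add: algebra_simps const_simps const_add)
  also have "const (inverse (a * b)) * (?R1 * ?V - ?S * ?R2) \<in> I"
    by (intro I_left I_minus I_right[OF R(1)] R(2))
  finally have V: "?V - ?S \<in> I" .
  let ?E = "gen GXi * gen GX - 1"
  let ?E' = "gen GX * gen GXi - 1"
  have E: "?E \<in> I" "?E' \<in> I" using cong_Xi_X cong_X_Xi by (simp_all add: cong_I_def)
  have "gen GT1 * gen GX - (gen GXi * ?S - const (a + b))
      = gen GXi * (?V - ?S) - ?E * (gen GT1 * gen GX + const (a + b))"
    by (simp add: algebra_simps const_simps const_add)
  also have "\<dots> \<in> I" by (intro I_minus I_left V I_right E)
  finally show "gen GT1 * gen GX \<doteq> gen GXi * ?S - const (a + b)"
    unfolding cong_I_def .
  have "gen GX * gen GT1 + const (a + b) - const (1 + a * b) * gen GXi - gen GT1 * gen GXi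
      = (?V - ?S) * gen GXi - (gen GX * gen GT1 + const (a + b)) * ?E'"
    by (simp add: algebra_simps const_simps const_add)
  also have "\<dots> \<in> I" by (intro I_minus I_right V I_left E)
  finally show "gen GT1 * gen GXi \<doteq> gen GX * gen GT1 + const (a + b) - const (1 + a * b) * gen GXi"
    unfolding cong_I_def using I_uminus by fastforce
qed

lemma cong_left: "x \<doteq> y \<Longrightarrow> p * x \<doteq> p * y"
  unfolding cong_I_def using I_left[of "x - y" p] by (simp add: algebra_simps)

lemma cong_right: "x \<doteq> y \<Longrightarrow> x * p \<doteq> y * p"
  unfolding cong_I_def using I_right[of "x - y" p] by (simp add: algebra_simps)

lemma cong_sym: "x \<doteq> y \<Longrightarrow> y \<doteq> x"
  unfolding cong_I_def using I_uminus[of "x - y"] by simp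

section \<open>Normal forms span\<close>

definition X_pow :: "int \<Rightarrow> hgen free_alg" where
  "X_pow n = (if n \<ge> 0 then gen GX ^ nat n else gen GXi ^ nat (- n))"

text \<open>
  There are two alternating words in \<open>T0\<close> and \<open>T1\<close> of each positive length; labelling them by
  integers \<open>k\<close> of either sign makes the labels agree with those of the orbit points.
\<close>

function T_word :: "int \<Rightarrow> hgen free_alg" where
  "T_word k = (if k = 0 then 1 else if k > 0 then gen GT0 * T_word (1 - k) else gen GT1 * T_word (- 1 - k))"
  by auto
termination by (relation "measure (\<lambda>k. nat \<bar>k\<bar>)") auto

declare T_word.simps [simp del]

text \<open>
  The elements congruent to a linear combination of \<open>X\<^sup>n w\<close> with \<open>w\<close> alternating. The aim is to
  show that this set contains \<open>1\<close> and is closed under left multiplication by each generator, hence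
  is everything.
\<close>

inductive_set normal_span :: "hgen free_alg set" where
  ideal: "x \<in> I \<Longrightarrow> x \<in> normal_span"
| monomial: "const c * X_pow n * T_word k \<in> normal_span"
| add: "x \<in> normal_span \<Longrightarrow> y \<in> normal_span \<Longrightarrow> x + y \<in> normal_span"

lemma span_cong: "x \<doteq> y \<Longrightarrow> y \<in> normal_span \<Longrightarrow> x \<in> normal_span"
  unfolding cong_I_def using normal_span.add[OF normal_span.ideal[of "x - y"], of y] by simp

lemma span_const: "x \<in> normal_span \<Longrightarrow> const c * x \<in> normal_span"
proof (induction rule: normal_span.induct)
  case (monomial d n k)
  show ?case
    using normal_span.monomial[of "c * d" n k] by (simp add: const_mult mult.assoc)
qed (auto simp: distrib_left intro: normal_span.ideal I_left normal_span.add)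

lemma span_minus: "x \<in> normal_span \<Longrightarrow> y \<in> normal_span \<Longrightarrow> x - y \<in> normal_span"
  using normal_span.add[OF _ span_const[of y "- 1"], of x] by (simp add: const_minus)

lemma span_X_pow_T_word: "X_pow n * T_word k \<in> normal_span"
  using normal_span.monomial[of 1 n k] by simp

lemma span_gen:
  assumes "\<And>n k. gen g * (X_pow n * T_word k) \<in> normal_span"
  shows "x \<in> normal_span \<Longrightarrow> gen g * x \<in> normal_span"
proof (induction rule: normal_span.induct)
  case (monomial c n k)
  show ?case
    using span_const[OF assms[of n k], of c] by (simp add: mult.assoc const_left_commute)
qed (auto simp: distrib_left intro: normal_span.ideal I_left normal_span.add)

lemma cong_X_X_pow: "gen GX * X_pow n \<doteq> X_pow (n + 1)"
proof (cases "n \<ge> 0")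
  case True
  then have "nat (n + 1) = Suc (nat n)" by simp
  with True show ?thesis by (simp add: X_pow_def cong_I_def)
next
  case False
  then have "nat (- n) = Suc (nat (- (n + 1)))" by simp
  with False have "X_pow n = gen GXi * X_pow (n + 1)" by (auto simp: X_pow_def)
  then show ?thesis using cong_right[OF cong_X_Xi, of "X_pow (n + 1)"] by (simp add: mult.assoc)
qed

lemma cong_Xi_X_pow: "gen GXi * X_pow n \<doteq> X_pow (n - 1)"
proof (cases "n \<ge> 1")
  case True
  then have "nat n = Suc (nat (n - 1))" by simp
  with True have "X_pow n = gen GX * X_pow (n - 1)" by (auto simp: X_pow_def)
  then show ?thesis using cong_right[OF cong_Xi_X, of "X_pow (n - 1)"] by (simp add: mult.assoc)
next
  case False
  then have "nat (- (n - 1)) = Suc (nat (- n))" by simp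
  with False show ?thesis by (cases "n = 0") (simp_all add: X_pow_def cong_I_def)
qed

lemma span_X: "x \<in> normal_span \<Longrightarrow> gen GX * x \<in> normal_span"
  by (rule span_gen, rule span_cong[OF cong_right[OF cong_X_X_pow, unfolded mult.assoc]], rule span_X_pow_T_word)

lemma span_Xi: "x \<in> normal_span \<Longrightarrow> gen GXi * x \<in> normal_span"
  by (rule span_gen, rule span_cong[OF cong_right[OF cong_Xi_X_pow, unfolded mult.assoc]], rule span_X_pow_T_word)

text \<open>
  A generator moves past a power of \<open>X\<close> one factor at a time; \<open>up\<close> and \<open>down\<close> express that its
  commutation rules with \<open>X\<close> and \<open>X\<^sup>-\<^sup>1\<close> stay inside the span.
\<close>

lemma span_T_monomial:
  assumes up: "\<And>y. y \<in> normal_span \<Longrightarrow> gen g * y \<in> normal_span \<Longrightarrow> gen g * (gen GX * y) \<in> normal_span"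
    and down: "\<And>y. y \<in> normal_span \<Longrightarrow> gen g * y \<in> normal_span \<Longrightarrow> gen g * (gen GXi * y) \<in> normal_span"
    and base: "gen g * T_word k \<in> normal_span"
  shows "gen g * (X_pow n * T_word k) \<in> normal_span"
proof (induction n rule: int_induct[of _ 0])
  case base
  show ?case using assms(3) by (simp add: X_pow_def)
next
  case (step1 n)
  have "gen g * (X_pow (n + 1) * T_word k) \<doteq> gen g * (gen GX * (X_pow n * T_word k))"
    using cong_left[OF cong_right[OF cong_sym[OF cong_X_X_pow]]] by (simp add: mult.assoc)
  then show ?case using up[OF span_X_pow_T_word step1.IH] by (rule span_cong)
next
  case (step2 n)
  have "gen g * (X_pow (n - 1) * T_word k) \<doteq> gen g * (gen GXi * (X_pow n * T_word k))"
    using cong_left[OF cong_right[OF cong_sym[OF cong_Xi_X_pow]]] by (simp add: mult.assoc)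
  then show ?case using down[OF span_X_pow_T_word step2.IH] by (rule span_cong)
qed

lemma span_T_word: "T_word k \<in> normal_span"
  using span_X_pow_T_word[of 0 k] by (simp add: X_pow_def)

lemma span_T0_T_word: "gen GT0 * T_word k \<in> normal_span"
proof (cases "k > 0")
  case True
  have "gen GT0 * T_word k \<doteq> 0"
    using cong_right[OF cong_T0_T0, of "T_word (1 - k)"] True by (subst T_word.simps) (simp add: mult.assoc)
  then show ?thesis by (rule span_cong) (simp add: normal_span.ideal)
next
  case False
  then have "gen GT0 * T_word k = T_word (1 - k)" by (subst (2) T_word.simps) simp
  then show ?thesis by (simp add: span_T_word)
qed

lemma span_T1_T_word: "gen GT1 * T_word k \<in> normal_span"
proof (cases "k < 0")
  case True
  let ?w = "T_word (- 1 - k)"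
  have w: "T_word k = gen GT1 * ?w" using True by (subst T_word.simps) simp
  have "gen GT1 * T_word k \<doteq> 0 - const (1 + a * b) * T_word k - const (a * b) * ?w"
    using cong_right[OF cong_T1_T1, of ?w] by (simp add: w mult.assoc left_diff_distrib)
  then show ?thesis
    by (rule span_cong) (intro span_minus span_const span_T_word normal_span.ideal I_zero)
next
  case False
  then have "gen GT1 * T_word k = T_word (- 1 - k)" by (subst (2) T_word.simps) simp
  then show ?thesis by (simp add: span_T_word)
qed

lemma span_T0: "x \<in> normal_span \<Longrightarrow> gen GT0 * x \<in> normal_span"
proof (rule span_gen, rule span_T_monomial)
  fix y assume y: "y \<in> normal_span" "gen GT0 * y \<in> normal_span"
  have "gen GT0 * (gen GX * y) \<doteq> const q * (gen GXi * (gen GT0 * y)) + y"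
    using cong_right[OF cong_T0_X, of y] by (simp add: algebra_simps)
  then show "gen GT0 * (gen GX * y) \<in> normal_span"
    by (rule span_cong) (intro normal_span.add span_const span_Xi y)
  have "gen GT0 * (gen GXi * y) \<doteq> const (inverse q) * (gen GX * (gen GT0 * y) - y)"
    using cong_right[OF cong_T0_Xi, of y] by (simp add: algebra_simps)
  then show "gen GT0 * (gen GXi * y) \<in> normal_span"
    by (rule span_cong) (intro span_minus span_const span_X y)
qed (rule span_T0_T_word)

lemma span_T1: "x \<in> normal_span \<Longrightarrow> gen GT1 * x \<in> normal_span"
proof (rule span_gen, rule span_T_monomial)
  fix y assume y: "y \<in> normal_span" "gen GT1 * y \<in> normal_span"
  have "gen GT1 * (gen GX * y)
      \<doteq> gen GXi * (gen GT1 * y + const (1 + a * b) * y) - const (a + b) * y"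
    using cong_right[OF cong_T1_X, of y] by (simp add: algebra_simps)
  then show "gen GT1 * (gen GX * y) \<in> normal_span"
    by (rule span_cong) (intro span_minus normal_span.add span_const span_Xi y)
  have "gen GT1 * (gen GXi * y)
      \<doteq> gen GX * (gen GT1 * y) + const (a + b) * y - const (1 + a * b) * (gen GXi * y)"
    using cong_right[OF cong_T1_Xi, of y] by (simp add: algebra_simps)
  then show "gen GT1 * (gen GXi * y) \<in> normal_span"
    by (rule span_cong) (intro span_minus normal_span.add span_const span_X span_Xi y)
qed (rule span_T1_T_word)

lemma span_all: "p \<in> normal_span"
proof (induction p rule: poly_mapping_additive_induct)
  case zero
  show ?case by (simp add: normal_span.ideal)
next
  case (single w c)
  have "Poly_Mapping.single (Word ls) 1 \<in> normal_span" for ls :: "hgen list"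
  proof (induction ls)
    case Nil
    have "Poly_Mapping.single (Word [] :: hgen free_monoid) (1::complex) = 1"
      by (simp flip: zero_free_monoid_def)
    moreover have "T_word 0 = 1" by (subst T_word.simps) simp
    ultimately show ?case using span_T_word[of 0] by simp
  next
    case (Cons g ls)
    have "Poly_Mapping.single (Word (g # ls)) (1::complex) = gen g * Poly_Mapping.single (Word ls) 1"
      by (simp add: gen_def mult_single plus_free_monoid_def)
    then show ?case
      using Cons by (cases g) (simp_all add: span_T0 span_T1 span_X span_Xi)
  qed
  from span_const[OF this[of "letters w"], of c] show ?case
    by (simp add: const_times_single)
qed (rule normal_span.add)

section \<open>Normal forms act independently\<close>

lemma rep_ring_hom: "ring_hom_ring free_alg_ring laurent_End rep"
proof (rule ring_hom_ringI2[OF ring_free_alg_ring ring_laurent_End], rule ring_hom_memI)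
  have "Vector_Spaces.linear laurent_scale laurent_scale (rep p)" for p
    unfolding Vector_Spaces.linear_iff
    by (simp add: vector_space_laurent_scale rep_vector_add rep_vector_scale laurent_scale_def)
  then show "rep p \<in> carrier laurent_End" for p by (simp add: laurent_End_def)
qed (auto simp: free_alg_ring_def laurent_End_def rep_mult rep_add fun_eq_iff)

lemma kernel_rep_eq: "a_kernel free_alg_ring laurent_End rep = {p. \<forall>f. rep p f = 0}"
  unfolding a_kernel_def' by (auto simp: free_alg_ring_def laurent_End_def fun_eq_iff)

text \<open>The kernel of the action is an ideal that contains the relations.\<close>

lemma rep_I: "p \<in> I \<Longrightarrow> rep p f = 0"
  using ring.genideal_minimal[OF ring_free_alg_ring ring_hom_ring.kernel_is_ideal[OF rep_ring_hom],
      of "hIII_relations q a b"] rep_relations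
  unfolding hIII_ideal_def kernel_rep_eq by blast

text \<open>
  A Laurent polynomial in \<open>X\<close>, read as an element of the free algebra. It is additive, but
  multiplicative only modulo the relations, because \<open>X\<close> and \<open>X\<^sup>-\<^sup>1\<close> are independent generators there.
\<close>

definition laurent_elt :: "laurent \<Rightarrow> hgen free_alg" where
  "laurent_elt f = lin const X_pow f"

lemma laurent_elt_additive: "additive_coeff laurent_elt"
  by unfold_locales (simp add: laurent_elt_def const.lin_add)

interpretation laurent_elt: additive_coeff laurent_elt by (rule laurent_elt_additive)

lemma laurent_elt_single: "laurent_elt (Poly_Mapping.single n c) = const c * X_pow n"
  by (simp add: laurent_elt_def)

lemma normal_form_exists: "\<exists>c. p - lin laurent_elt T_word c \<in> I"
proof -
  have "p \<in> normal_span \<Longrightarrow> \<exists>c. p - lin laurent_elt T_word c \<in> I"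
  proof (induction rule: normal_span.induct)
    case (ideal x)
    then show ?case by (intro exI[of _ 0]) simp
  next
    case (monomial c n k)
    show ?case
      by (intro exI[of _ "Poly_Mapping.single k (Poly_Mapping.single n c)"]) (simp add: laurent_elt_single)
  next
    case (add x y)
    then obtain c d where "x - lin laurent_elt T_word c \<in> I" "y - lin laurent_elt T_word d \<in> I" by blast
    from I_add[OF this] show ?case
      by (intro exI[of _ "c + d"]) (simp add: laurent_elt.lin_add algebra_simps)
  qed
  then show ?thesis using span_all by blast
qed

lemma rep_power: "rep (p ^ n) f = (rep p ^^ n) f"
  by (induction n) (simp_all add: rep_mult)

lemma rep_X_pow: "rep (X_pow n) f = zpow n * f"
proof -
  have "((\<lambda>f. zpow k * f) ^^ m) f = zpow (int m * k) * f" for k m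
    by (induction m) (simp_all add: mult.assoc[symmetric] mult_single algebra_simps)
  moreover have "rep (gen GX) = (\<lambda>f. zpow 1 * f)" "rep (gen GXi) = (\<lambda>f. zpow (-1) * f)"
    by (simp_all add: fun_eq_iff)
  ultimately show ?thesis
    by (simp add: X_pow_def rep_power)
qed

lemma rep_laurent_elt: "rep (laurent_elt g) f = g * f"
  by (induction g rule: poly_mapping_additive_induct)
    (simp_all add: laurent_elt_def const.lin_add rep_add rep_mult rep_X_pow distrib_right
      mult.assoc[symmetric] const_times_single)

lemma rep_lin: "rep (lin laurent_elt T_word c) f = (\<Sum>k\<in>Poly_Mapping.keys c. Poly_Mapping.lookup c k * rep (T_word k) f)"
proof -
  have "rep (sum h A) f = (\<Sum>k\<in>A. rep (h k) f)" for h :: "int \<Rightarrow> hgen free_alg" and A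
    by (induction A rule: infinite_finite_induct) (simp_all add: rep_add)
  then show ?thesis by (simp add: lin_def rep_mult rep_laurent_elt)
qed

text \<open>
  Peel off the first letter. Its operator combines the value of \<open>w' f\<close> at \<open>z\<close>, for the remaining
  word \<open>w'\<close>, with the one at the reflected point. The first involves only labels smaller in absolute
  value than \<open>\<bar>k\<bar>\<close>, where \<open>f\<close> vanishes; the second leads to the \<open>k\<close>-th orbit point, because
  reflecting the base point shifts the labels in the same way as prepending the letter.
\<close>

lemma leading_term:
  assumes "generic z"
  shows "\<exists>C. C \<noteq> 0 \<and> (\<forall>f. (\<forall>j. \<bar>j\<bar> < \<bar>k\<bar> \<longrightarrow> value_at (orbit j z) f = 0)
    \<longrightarrow> value_at z (rep (T_word k) f) = C * value_at (orbit k z) f)"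
  using assms
proof (induction k arbitrary: z rule: T_word.induct)
  case (1 k)
  note gen = genericD[OF \<open>generic z\<close>]
  consider "k = 0" | "k > 0" | "k < 0" by linarith
  then show ?case
  proof cases
    case 1
    then have "T_word k = 1" by (subst T_word.simps) simp
    then show ?thesis using 1 by (intro exI[of _ 1]) simp
  next
    case 2
    have T_word: "T_word k = gen GT0 * T_word (1 - k)" using 2 by (subst T_word.simps) simp
    obtain C where C: "\<And>f. (\<forall>j. \<bar>j\<bar> < \<bar>1 - k\<bar> \<longrightarrow> value_at (orbit j z) f = 0)
        \<Longrightarrow> value_at z (rep (T_word (1 - k)) f) = C * value_at (orbit (1 - k) z) f"
      using "1.IH"(1)[OF _ _ \<open>generic z\<close>] 2 by auto
    obtain C' where C': "C' \<noteq> 0" "\<And>f. (\<forall>j. \<bar>j\<bar> < \<bar>1 - k\<bar> \<longrightarrow> value_at (orbit j (q / z)) f = 0)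
        \<Longrightarrow> value_at (q / z) (rep (T_word (1 - k)) f) = C' * value_at (orbit (1 - k) (q / z)) f"
      using "1.IH"(1)[OF _ _ generic_T0[OF \<open>generic z\<close>]] 2 by auto
    have "value_at z (rep (T_word k) f) = z / (q - z\<^sup>2) * C' * value_at (orbit k z) f"
      if f: "\<forall>j. \<bar>j\<bar> < \<bar>k\<bar> \<longrightarrow> value_at (orbit j z) f = 0" for f
    proof -
      have "value_at z (rep (T_word (1 - k)) f) = 0"
        using C[of f] f 2 by simp
      moreover have "value_at (q / z) (rep (T_word (1 - k)) f) = C' * value_at (orbit k z) f"
        using C'(2)[of f] f 2 gen(1) by (simp add: orbit_T0)
      ultimately show ?thesis
        using gen by (simp add: T_word rep_mult T0_at)
    qed
    then show ?thesis
      using gen C'(1) by (intro exI[of _ "z / (q - z\<^sup>2) * C'"]) auto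
  next
    case 3
    have T_word: "T_word k = gen GT1 * T_word (- 1 - k)" using 3 by (subst T_word.simps) simp
    obtain C where C: "\<And>f. (\<forall>j. \<bar>j\<bar> < \<bar>- 1 - k\<bar> \<longrightarrow> value_at (orbit j z) f = 0)
        \<Longrightarrow> value_at z (rep (T_word (- 1 - k)) f) = C * value_at (orbit (- 1 - k) z) f"
      using "1.IH"(2)[OF _ _ \<open>generic z\<close>] 3 by auto
    obtain C' where C': "C' \<noteq> 0" "\<And>f. (\<forall>j. \<bar>j\<bar> < \<bar>- 1 - k\<bar> \<longrightarrow> value_at (orbit j (inverse z)) f = 0)
        \<Longrightarrow> value_at (inverse z) (rep (T_word (- 1 - k)) f) = C' * value_at (orbit (- 1 - k) (inverse z)) f"
      using "1.IH"(2)[OF _ _ generic_T1[OF \<open>generic z\<close>]] 3 by auto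
    have "value_at z (rep (T_word k) f) = T1_coeff z * C' * value_at (orbit k z) f"
      if f: "\<forall>j. \<bar>j\<bar> < \<bar>k\<bar> \<longrightarrow> value_at (orbit j z) f = 0" for f
    proof -
      have "value_at z (rep (T_word (- 1 - k)) f) = 0"
        using C[of f] f 3 by simp
      moreover have "value_at (inverse z) (rep (T_word (- 1 - k)) f) = C' * value_at (orbit k z) f"
        using C'(2)[of f] f 3 gen(1) by (simp add: orbit_T1)
      ultimately show ?thesis
        using gen by (simp add: T_word rep_mult T1_at_eigen)
    qed
    moreover have "T1_coeff z \<noteq> 0"
      using gen by (auto simp: T1_coeff_def)
    ultimately show ?thesis
      using C'(1) by (intro exI[of _ "T1_coeff z * C'"]) auto
  qed
qed

text \<open>
  The term with the largest label in absolute value is isolated by interpolation. Besides shorter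
  words, this has to suppress the other alternating word of the same length, whose leading point
  carries the opposite label.
\<close>

lemma normal_forms_independent:
  assumes zero: "\<And>f. (\<Sum>k\<in>Poly_Mapping.keys c. Poly_Mapping.lookup c k * rep (T_word k) f) = 0"
  shows "c = 0"
proof (rule ccontr)
  let ?K = "Poly_Mapping.keys c"
  assume "c \<noteq> 0"
  then have K: "?K \<noteq> {}" "finite ?K" by simp_all
  then have "Max (abs ` ?K) \<in> abs ` ?K" by (intro Max_in) simp_all
  then obtain m where m0: "m \<in> ?K" "\<bar>m\<bar> = Max (abs ` ?K)" by auto
  have m: "m \<in> ?K" "\<And>k. k \<in> ?K \<Longrightarrow> \<bar>k\<bar> \<le> \<bar>m\<bar>"
    using m0 by simp_all
  have "value_at z (Poly_Mapping.lookup c m) = 0" if z: "generic z" for z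
  proof -
    have z0: "z \<noteq> 0" using z by (rule genericD)
    let ?S = "(\<lambda>j. orbit j z) ` ({- \<bar>m\<bar>..\<bar>m\<bar>} - {m})"
    obtain f where f: "\<forall>y\<in>?S. value_at y f = 0" "value_at (orbit m z) f \<noteq> 0"
      using interpolation[of ?S "orbit m z"] orbit_inj[OF z] orbit_nonzero[OF z0] by fastforce
    have f0: "value_at (orbit j z) f = 0" if "\<bar>j\<bar> \<le> \<bar>m\<bar>" "j \<noteq> m" for j
      using f(1) that by (auto simp: abs_le_iff)
    have lead: "\<exists>C. C \<noteq> 0 \<and> value_at z (rep (T_word k) f) = C * value_at (orbit k z) f"
      if "k \<in> ?K" for k
    proof -
      have "value_at (orbit j z) f = 0" if "\<bar>j\<bar> < \<bar>k\<bar>" for j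
        using f0[of j] m(2)[OF \<open>k \<in> ?K\<close>] that by auto
      then show ?thesis using leading_term[OF z, of k] by blast
    qed
    obtain C where C: "C \<noteq> 0" "value_at z (rep (T_word m) f) = C * value_at (orbit m z) f"
      using lead[OF m(1)] by blast
    have other: "value_at z (rep (T_word k) f) = 0" if "k \<in> ?K - {m}" for k
      using lead[of k] f0[of k] m(2)[of k] that by auto
    have "0 = value_at z (\<Sum>k\<in>?K. Poly_Mapping.lookup c k * rep (T_word k) f)"
      by (simp add: zero)
    also have "\<dots> = (\<Sum>k\<in>?K. value_at z (Poly_Mapping.lookup c k * rep (T_word k) f))"
      by (rule value_at_sum)
    also have "\<dots> = value_at z (Poly_Mapping.lookup c m) * (C * value_at (orbit m z) f)"
      using K m(1) other by (simp add: value_at_mult[OF z0] sum.remove[of ?K m] C(2))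
    finally show ?thesis using C(1) f(2) by simp
  qed
  then have "Poly_Mapping.lookup c m = 0"
    by (intro eq_if_eq_at_generic) simp
  then show False using m(1) by (simp add: in_keys_iff)
qed

lemma kernel_rep: "p \<in> I \<longleftrightarrow> (\<forall>f. rep p f = 0)"
proof
  assume "\<forall>f. rep p f = 0"
  moreover obtain c where c: "p - lin laurent_elt T_word c \<in> I" using normal_form_exists by blast
  ultimately have "rep (lin laurent_elt T_word c) f = 0" for f
    using rep_I[OF c, of f] by (simp add: rep_minus)
  then have "c = 0" by (intro normal_forms_independent) (simp add: rep_lin)
  with c show "p \<in> I" by simp
qed (simp add: rep_I)

section \<open>The induced representation of the quotient\<close>

lemma I_eq_kernel: "I = a_kernel free_alg_ring laurent_End rep"
  unfolding kernel_rep_eq using kernel_rep by blast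

definition quot_rep :: "hgen free_alg set \<Rightarrow> laurent \<Rightarrow> laurent" where
  "quot_rep x = the_elem (rep ` x)"

lemma quot_rep_class: "quot_rep (hIII_class q a b p) = rep p"
  unfolding quot_rep_def hIII_class_def I_eq_kernel
  by (rule ring_hom_ring.the_elem_simp[OF rep_ring_hom]) (simp add: free_alg_ring_def)

lemma quot_rep_hom: "quot_rep \<in> ring_hom (hIII q a b) laurent_End"
  using ring_hom_ring.the_elem_hom[OF rep_ring_hom]
  unfolding hIII_def I_eq_kernel quot_rep_def[abs_def] .

lemma quot_rep_inj: "inj_on quot_rep (carrier (hIII q a b))"
  unfolding hIII_def I_eq_kernel quot_rep_def[abs_def]
  by (intro inj_onI ring_hom_ring.the_elem_inj[OF rep_ring_hom])

lemma quot_rep_representation: "hIII_representation q a b quot_rep"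
  unfolding hIII_representation_def
proof (intro conjI quot_rep_hom allI ballI)
  fix c x f assume x: "x \<in> carrier (hIII q a b)"
  have c: "hIII_class q a b (const c) \<in> carrier (hIII q a b)"
    by (auto simp: hIII_class_def hIII_def FactRing_def A_RCOSETS_def' free_alg_ring_def)
  show "quot_rep (hIII_scale q a b c x) f = laurent_scale c (quot_rep x f)"
    unfolding hIII_scale_def ring_hom_mult[OF quot_rep_hom c x] quot_rep_class
    by (simp add: laurent_End_def laurent_scale_def)
qed

lemma T0_formula_T0: "laurent_eval (T0 f) rat_z = T0_formula q f"
  unfolding laurent_eval_eq_val T0_formula_def
  by (subst val_T0[OF rat.coeff_hom_axioms rat_z_nonzero rat_const_minus_square_nonzero])
    (simp add: divide_inverse)

lemma T1_formula_T1: "laurent_eval (T1 f) rat_z = T1_formula a b f"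
proof -
  have "1 - rat_z\<^sup>2 \<noteq> 0" using rat_const_minus_square_nonzero[of 1] by (simp add: rat_const_1)
  then show ?thesis
    unfolding laurent_eval_eq_val T1_formula_def
    by (rule val_T1[OF rat.coeff_hom_axioms rat_z_nonzero])
qed

end

theorem theorem3p2:
  fixes q a b :: complex
  assumes "q \<noteq> 0" and "a \<noteq> 0" and "b \<noteq> 0"
    and "\<forall>m::nat. m \<ge> 1 \<longrightarrow> q ^ m \<noteq> 1"
  shows "\<exists>T0 T1 X Xi :: laurent \<Rightarrow> laurent.
      (\<forall>f. laurent_eval (T0 f) rat_z = T0_formula q f) \<and>
      (\<forall>f. laurent_eval (T1 f) rat_z = T1_formula a b f) \<and>
      (\<forall>f. laurent_eval (X f) rat_z = rat_z * laurent_eval f rat_z) \<and>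
      (\<forall>f. laurent_eval (Xi f) rat_z = inverse rat_z * laurent_eval f rat_z) \<and>
      (\<exists>\<phi>. hIII_representation q a b \<phi> \<and>
           \<phi> (hIII_class q a b (gen GT0)) = T0 \<and>
           \<phi> (hIII_class q a b (gen GT1)) = T1 \<and>
           \<phi> (hIII_class q a b (gen GX)) = X \<and>
           \<phi> (hIII_class q a b (gen GXi)) = Xi \<and>
           inj_on \<phi> (carrier (hIII q a b)))"
proof -
  interpret hIII_parameters q a b
    using assms by unfold_locales auto
  have X: "laurent_eval (zpow 1 * f) rat_z = rat_z * laurent_eval f rat_z"
    and Xi: "laurent_eval (zpow (-1) * f) rat_z = inverse rat_z * laurent_eval f rat_z" for f
    by (simp_all add: laurent_eval_eq_val rat.val_mult[OF rat_z_nonzero] power_int_minus)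
  show ?thesis
    by (rule exI[of _ T0], rule exI[of _ T1], rule exI[of _ "\<lambda>f. zpow 1 * f"],
        rule exI[of _ "\<lambda>f. zpow (-1) * f"], intro conjI exI[of _ quot_rep])
      (simp_all add: T0_formula_T0 T1_formula_T1 X Xi quot_rep_representation quot_rep_class
        quot_rep_inj fun_eq_iff)
qed

end
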